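(* Let $q=q(c(x),\xi)$ be a symbol that depends on the spatial variable $x\in\mathbb{R}^d$ only through the function $c=c(x)$, and let $$(Qv)(x)=(2\pi)^{-d/2}\int_{\mathbb{R}^d} q(c(x),\xi)\,\hat v(\xi)\,e^{ix\cdot\xi}\,d\xi .$$ Let $c_1,\dots,c_M$ be interpolation points with interpolating basis $\varphi_1,\dots,\varphi_M$, and let $$(Q_M v)(x)=(2\pi)^{-d/2}\sum_{m=1}^{M}\varphi_m(c(x))\int_{\mathbb{R}^d} q(c_m,\xi)\,\hat v(\xi)\,e^{ix\cdot\xi}\,d\xi .$$ Consider the algorithm that approximates the action of $Q$ on $v$ by evaluating $Q_M v$ on a regular $d$-dimensional grid with $N$ points in each coordinate direction, by computing one FFT of $v$ followed by the sum (weighted by $\varphi_m(c(x))$) of $M$ inverse FFTs, one for each input $q(c_m,\xi)\hat v(\xi)$, $m=1,\dots,M$. This algorithm has $\mathcal{O}(M N^d\log N)$ complexity.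
   Context: Here $c:\mathbb{R}^d\to\mathbb{R}$ is a smooth real-valued function with $0<c_{\min}\le c\le c_{\max}<\infty$, and $\hat v(\xi)=(2\pi)^{-d/2}\int v(x)e^{-ix\cdot\xi}\,dx$ is the Fourier transform of $v$. The set $\{c_1,\dots,c_M\}\subset[c_{\min},c_{\max}]$ is a finite ordered set of distinct points with $c_1=c_{\min}$ and $c_M=c_{\max}$, and each $\varphi_m:[c_{\min},c_{\max}]\to[0,1]$ is a function with $\varphi_m(c_m)=1$ and $\varphi_m(c_n)=0$ for all $n\neq m$. The complexity is analyzed in terms of the number of multiplications and the discretization of the spatial domain: a hypercube containing the support of the input function $v$ is discretized by a regular $d$-dimensional grid with $N$ points in each coordinate direction, so there are $N^d$ evaluation points (degrees of freedom). The discrete Fourier transform and its inverse are assumed to be computed with FFT-type algorithms of one-dimensional complexity $\mathcal{O}(N\log N)$. *)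

theory Defs
  imports "HOL-Analysis.Analysis" "HOL-Library.Landau_Symbols"
begin

section \<open>The operators\<close>

primrec C_k :: "nat \<Rightarrow> (real ^ 'd \<Rightarrow> real) \<Rightarrow> bool" where
  "C_k 0 f \<longleftrightarrow> continuous_on UNIV f"
| "C_k (Suc n) f \<longleftrightarrow> f differentiable_on UNIV \<and>
     (\<forall>i. C_k n (\<lambda>x. frechet_derivative f (at x) (axis i 1)))"

definition smooth :: "(real ^ 'd \<Rightarrow> real) \<Rightarrow> bool" where
  "smooth f \<longleftrightarrow> (\<forall>n. C_k n f)"

definition interpolation_basis ::
    "real \<Rightarrow> real \<Rightarrow> nat \<Rightarrow> (nat \<Rightarrow> real) \<Rightarrow> (nat \<Rightarrow> real \<Rightarrow> real) \<Rightarrow> bool" where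
  "interpolation_basis cmin cmax M cs \<phi> \<longleftrightarrow>
     1 \<le> M \<and> strict_mono_on {1..M} cs \<and> cs 1 = cmin \<and> cs M = cmax \<and>
     (\<forall>m\<in>{1..M}. \<phi> m \<in> {cmin..cmax} \<rightarrow> {0..1}) \<and>
     (\<forall>m\<in>{1..M}. \<forall>n\<in>{1..M}. \<phi> m (cs n) = (if n = m then 1 else 0))"

text \<open>
  All integrals are taken with respect to a spatial measure \<open>\<mu>\<close> and a frequency measure \<open>\<nu>\<close>.
  The operators \<open>Q\<close> and \<open>Q\<^sub>M\<close> on \<open>\<real>\<^sup>d\<close> are the instances \<open>\<mu> = \<nu> = lborel\<close>;
  their discretizations on a grid are the instances in which \<open>\<mu>\<close> and \<open>\<nu>\<close> are the
  quadrature rules defined below.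
\<close>

definition fourier_factor :: "'d::finite itself \<Rightarrow> complex" where
  "fourier_factor _ = complex_of_real ((2 * pi) powr (- real CARD('d) / 2))"

definition fourier_transform ::
    "(real ^ 'd) measure \<Rightarrow> (real ^ 'd \<Rightarrow> complex) \<Rightarrow> real ^ 'd \<Rightarrow> complex" where
  "fourier_transform \<mu> v \<xi> =
     fourier_factor TYPE('d) * (LINT x|\<mu>. v x * cis (- (x \<bullet> \<xi>)))"

definition symbol_operator ::
    "(real ^ 'd) measure \<Rightarrow> (real ^ 'd) measure \<Rightarrow> (real \<Rightarrow> real ^ 'd \<Rightarrow> complex) \<Rightarrow>
     (real ^ 'd \<Rightarrow> real) \<Rightarrow> (real ^ 'd \<Rightarrow> complex) \<Rightarrow> real ^ 'd \<Rightarrow> complex" where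
  "symbol_operator \<mu> \<nu> q c v x =
     fourier_factor TYPE('d) *
     (LINT \<xi>|\<nu>. q (c x) \<xi> * fourier_transform \<mu> v \<xi> * cis (x \<bullet> \<xi>))"

definition interpolated_operator ::
    "(real ^ 'd) measure \<Rightarrow> (real ^ 'd) measure \<Rightarrow> (real \<Rightarrow> real ^ 'd \<Rightarrow> complex) \<Rightarrow>
     (real ^ 'd \<Rightarrow> real) \<Rightarrow> nat \<Rightarrow> (nat \<Rightarrow> real) \<Rightarrow> (nat \<Rightarrow> real \<Rightarrow> real) \<Rightarrow>
     (real ^ 'd \<Rightarrow> complex) \<Rightarrow> real ^ 'd \<Rightarrow> complex" where
  "interpolated_operator \<mu> \<nu> q c M cs \<phi> v x =
     fourier_factor TYPE('d) *
     (\<Sum>m=1..M. complex_of_real (\<phi> m (c x)) *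
        (LINT \<xi>|\<nu>. q (cs m) \<xi> * fourier_transform \<mu> v \<xi> * cis (x \<bullet> \<xi>)))"

lemma interpolated_operator_at_node:
  assumes "interpolation_basis cmin cmax M cs \<phi>" "n \<in> {1..M}" "c x = cs n"
  shows "interpolated_operator \<mu> \<nu> q c M cs \<phi> v x = symbol_operator \<mu> \<nu> q c v x"
proof -
  have "(\<Sum>m=1..M. complex_of_real (\<phi> m (c x)) * I m) = I n" for I :: "nat \<Rightarrow> complex"
  proof -
    have "(\<Sum>m=1..M. complex_of_real (\<phi> m (c x)) * I m)
        = (\<Sum>m=1..M. if n = m then I m else 0)"
      using assms by (intro sum.cong) (auto simp: interpolation_basis_def)
    then show ?thesis using assms(2) by simp
  qed
  then show ?thesis
    by (simp add: interpolated_operator_def symbol_operator_def assms(3))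
qed


section \<open>The grid\<close>

text \<open>
  The hypercube with lower corner \<open>a\<close> and side length \<open>L\<close> carries the periodic grid with \<open>N\<close>
  points in each direction. The dual grid consists of the frequencies
  \<open>2 * pi / L * k\<close> with \<open>-N/2 \<le> k < N/2\<close>, stored in the usual wrap-around order.
\<close>

definition hypercube :: "real ^ 'd \<Rightarrow> real \<Rightarrow> (real ^ 'd) set" where
  "hypercube a L = cbox a (a + (\<chi> i. L))"

definition grid :: "nat \<Rightarrow> ('d \<Rightarrow> nat) set" where
  "grid N = {j. \<forall>i. j i < N}"

definition grid_point :: "real ^ 'd \<Rightarrow> real \<Rightarrow> nat \<Rightarrow> ('d \<Rightarrow> nat) \<Rightarrow> real ^ 'd" where
  "grid_point a L N j = (\<chi> i. a $ i + L / real N * real (j i))"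

definition grid_freq :: "real \<Rightarrow> nat \<Rightarrow> ('d \<Rightarrow> nat) \<Rightarrow> real ^ 'd" where
  "grid_freq L N k =
     (\<chi> i. 2 * pi / L * (if 2 * k i < N then real (k i) else real (k i) - real N))"

definition space_quadrature :: "real ^ 'd \<Rightarrow> real \<Rightarrow> nat \<Rightarrow> (real ^ 'd) measure" where
  "space_quadrature a L N =
     point_measure (grid_point a L N ` grid N) (\<lambda>_. ennreal ((L / real N) ^ CARD('d)))"

definition freq_quadrature :: "real \<Rightarrow> nat \<Rightarrow> (real ^ 'd) measure" where
  "freq_quadrature L N =
     point_measure (grid_freq L N ` grid N) (\<lambda>_. ennreal ((2 * pi / L) ^ CARD('d)))"


section \<open>Computations with a count of the multiplications\<close>

text \<open>
  A counted computation is its result together with the number of complex multiplications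
  performed. Additions, memory access and the provision of the samples of the input data
  (\<open>v\<close>, \<open>q (cs m)\<close>, \<open>\<phi> m \<circ> c\<close>) are free.
\<close>

type_synonym 'a counted = "'a \<times> nat"

abbreviation result :: "'a counted \<Rightarrow> 'a" where "result \<equiv> fst"
abbreviation mults :: "'a counted \<Rightarrow> nat" where "mults \<equiv> snd"

definition return :: "'a \<Rightarrow> 'a counted" where
  "return x = (x, 0)"

definition seq :: "'a counted \<Rightarrow> ('a \<Rightarrow> 'b counted) \<Rightarrow> 'b counted" (infixl "\<rhd>" 54) where
  "p \<rhd> f = (result (f (result p)), mults p + mults (f (result p)))"

definition mult :: "complex \<Rightarrow> complex \<Rightarrow> complex counted" where
  "mult x y = (x * y, 1)"

definition for_each :: "'i set \<Rightarrow> ('i \<Rightarrow> 'a counted) \<Rightarrow> ('i \<Rightarrow> 'a) counted" where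
  "for_each I f = (restrict (\<lambda>i. result (f i)) I, \<Sum>i\<in>I. mults (f i))"


section \<open>Fast Fourier transforms\<close>

definition dft :: "nat \<Rightarrow> (nat \<Rightarrow> complex) \<Rightarrow> nat \<Rightarrow> complex" where
  "dft N u k = (\<Sum>j<N. u j * cis (- (2 * pi * real j * real k / real N)))"

definition inverse_dft :: "nat \<Rightarrow> (nat \<Rightarrow> complex) \<Rightarrow> nat \<Rightarrow> complex" where
  "inverse_dft N u j =
     1 / of_nat N * (\<Sum>k<N. u k * cis (2 * pi * real j * real k / real N))"

type_synonym routine = "nat \<Rightarrow> (nat \<Rightarrow> complex) \<Rightarrow> (nat \<Rightarrow> complex) counted"

definition fft_algorithm :: "routine \<Rightarrow> (nat \<Rightarrow> (nat \<Rightarrow> complex) \<Rightarrow> nat \<Rightarrow> complex) \<Rightarrow> bool" where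
  "fft_algorithm F D \<longleftrightarrow>
     (\<forall>N u. \<forall>k<N. result (F N u) k = D N u k) \<and>
     (\<exists>T :: nat \<Rightarrow> nat. (\<forall>N u. mults (F N u) \<le> T N) \<and>
        (\<lambda>N. real (T N)) \<in> O(\<lambda>N. real N * ln (real N)))"

text \<open>
  A multidimensional transform is computed axis by axis; along an axis \<open>i\<close>, the one-dimensional
  routine is applied to each of the \<open>N ^ (d - 1)\<close> grid lines parallel to that axis, which are
  indexed by their points \<open>l\<close> with \<open>l i = 0\<close>.
\<close>

definition axis_pass ::
    "routine \<Rightarrow> nat \<Rightarrow> 'd \<Rightarrow> (('d \<Rightarrow> nat) \<Rightarrow> complex) \<Rightarrow> (('d \<Rightarrow> nat) \<Rightarrow> complex) counted" where
  "axis_pass F N i u =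
     for_each {l \<in> grid N. l i = 0} (\<lambda>l. F N (\<lambda>t. u (l(i := t))))
     \<rhd> (\<lambda>r. return (\<lambda>j. r (j(i := 0)) (j i)))"

primrec axis_passes ::
    "routine \<Rightarrow> nat \<Rightarrow> 'd list \<Rightarrow> (('d \<Rightarrow> nat) \<Rightarrow> complex) \<Rightarrow> (('d \<Rightarrow> nat) \<Rightarrow> complex) counted" where
  "axis_passes F N [] u = return u"
| "axis_passes F N (i # is) u = axis_pass F N i u \<rhd> axis_passes F N is"

definition all_axes :: "'d::finite list" where
  "all_axes = (SOME is. distinct is \<and> set is = UNIV)"

definition grid_transform ::
    "routine \<Rightarrow> nat \<Rightarrow> (('d::finite \<Rightarrow> nat) \<Rightarrow> complex) \<Rightarrow> (('d \<Rightarrow> nat) \<Rightarrow> complex) counted" where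
  "grid_transform F N u = axis_passes F N all_axes u"


section \<open>The algorithm\<close>

definition interpolation_algorithm ::
    "routine \<Rightarrow> routine \<Rightarrow> real ^ 'd \<Rightarrow> real \<Rightarrow> nat \<Rightarrow> (real \<Rightarrow> real ^ 'd \<Rightarrow> complex) \<Rightarrow>
     (real ^ 'd \<Rightarrow> real) \<Rightarrow> nat \<Rightarrow> (nat \<Rightarrow> real) \<Rightarrow> (nat \<Rightarrow> real \<Rightarrow> real) \<Rightarrow>
     (real ^ 'd \<Rightarrow> complex) \<Rightarrow> (('d \<Rightarrow> nat) \<Rightarrow> complex) counted" where
  "interpolation_algorithm fft ifft a L N q c M cs \<phi> v =
     grid_transform fft N (\<lambda>j. v (grid_point a L N j))
     \<rhd> (\<lambda>w. for_each {1..M} (\<lambda>m.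
          for_each (grid N) (\<lambda>k. mult (q (cs m) (grid_freq L N k)) (w k))
          \<rhd> grid_transform ifft N
          \<rhd> (\<lambda>u. for_each (grid N)
               (\<lambda>j. mult (complex_of_real (\<phi> m (c (grid_point a L N j)))) (u j)))))
     \<rhd> (\<lambda>y. return (\<lambda>j. \<Sum>m=1..M. y m j))"

end

theory Submission
  imports Defs
begin

text \<open>
  Passing from grid points and frequencies to their indices, the phases caused by the lower corner
  of the hypercube cancel between the Fourier transform and its inverse, and the quadrature weights
  together with the two Fourier factors combine to \<open>1 / N ^ d\<close>, the normalization of the inverse
  DFT. A transform costs \<open>d * N ^ (d - 1)\<close> one-dimensional transforms; there are \<open>M + 1\<close> of them,
  besides \<open>2 * M * N ^ d\<close> pointwise multiplications, which are absorbed since \<open>ln 2 \<le> ln N\<close>.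
\<close>

section \<open>Counting grid points and grid lines\<close>

lemma grid_eq_PiE: "grid N = (UNIV \<rightarrow>\<^sub>E {..<N})"
  by (auto simp: grid_def)

lemma finite_grid [simp]: "finite (grid N :: ('d::finite \<Rightarrow> nat) set)"
  unfolding grid_eq_PiE by (intro finite_PiE) auto

lemma card_grid: "card (grid N :: ('d::finite \<Rightarrow> nat) set) = N ^ CARD('d)"
  by (simp add: grid_eq_PiE card_PiE)

lemma card_grid_lines:
  fixes i :: "'d::finite"
  assumes "0 < N"
  shows "card {l \<in> grid N. l i = 0} = N ^ (CARD('d) - 1)"
proof -
  \<comment> \<open>Fixing one coordinate removes one factor \<open>N\<close> from the product. The
    fixed value 0 is an admissible index because \<open>0 < N\<close>.\<close>
  have "{l \<in> grid N. l i = 0} = (\<Pi>\<^sub>E x\<in>UNIV. if x = i then {0} else {..<N})"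
  proof (intro set_eqI iffI)
    fix l
    assume "l \<in> (\<Pi>\<^sub>E x\<in>UNIV. if x = i then {0} else {..<N})"
    then have l: "l x \<in> (if x = i then {0} else {..<N})" for x by (rule PiE_mem) simp
    have "l x < N" for x using l[of x] assms by (cases "x = i") auto
    then show "l \<in> {l \<in> grid N. l i = 0}" using l[of i] by (simp add: grid_def)
  qed (auto simp: grid_def)
  then have "card {l \<in> grid N. l i = 0} = (\<Prod>x\<in>UNIV. card (if x = i then {0} else {..<N}))"
    by (simp add: card_PiE)
  also have "\<dots> = (\<Prod>x\<in>UNIV - {i}. N)"
    by (subst prod.remove[of _ i]) (auto intro!: prod.cong)
  finally show ?thesis by simp
qed

section \<open>Values and cost of axis-by-axis transforms\<close>

lemma set_all_axes: "distinct (all_axes :: 'd::finite list)" "set (all_axes :: 'd list) = UNIV"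
proof -
  have "\<exists>is :: 'd list. distinct is \<and> set is = UNIV"
    using finite_distinct_list[of "UNIV :: 'd set"] by auto
  from someI_ex[OF this] show "distinct (all_axes :: 'd list)" "set (all_axes :: 'd list) = UNIV"
    by (simp_all add: all_axes_def)
qed

text \<open>Each pass sums out one coordinate against the one-dimensional kernel
  \<open>\<kappa>\<close>, so the kernels multiply. The induction needs partial lists of axes:
  coordinates not yet transformed stay frozen at those of \<open>j\<close>. Distinctness ensures
  that no axis contributes twice.\<close>

lemma result_axis_passes:
  fixes \<kappa> :: "nat \<Rightarrow> nat \<Rightarrow> complex"
  assumes F: "\<And>u k. k < N \<Longrightarrow> result (F N u) k = (\<Sum>t<N. u t * \<kappa> t k)"
    and "0 < N" "distinct is" "j \<in> grid N"
  shows "result (axis_passes F N is u) (j :: 'd::finite \<Rightarrow> nat) =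
    (\<Sum>l | l \<in> grid N \<and> (\<forall>i. i \<notin> set is \<longrightarrow> l i = j i). u l * (\<Prod>i\<in>set is. \<kappa> (l i) (j i)))"
  using assms(3,4)
proof (induction "is" arbitrary: u)
  case Nil
  then have "{l \<in> grid N. \<forall>i. l i = j i} = {j}" by auto
  then show ?case by (simp add: return_def)
next
  case (Cons i "is")
  let ?A = "\<lambda>is. {l \<in> grid N. \<forall>i. i \<notin> set is \<longrightarrow> l i = j i}"
  let ?p = "\<lambda>l. \<Prod>i\<in>set is. \<kappa> (l i) (j i)"
  have i: "i \<notin> set is" and dist: "distinct is" and j: "j \<in> grid N" using Cons.prems by auto
  have step: "result (axis_pass F N i u) l = (\<Sum>t<N. u (l(i := t)) * \<kappa> t (l i))"
    if "l \<in> grid N" for l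
    using that \<open>0 < N\<close> by (simp add: axis_pass_def seq_def for_each_def return_def grid_def F)
  have "result (axis_passes F N (i # is) u) j = (\<Sum>l\<in>?A is. result (axis_pass F N i u) l * ?p l)"
    by (simp add: seq_def Cons.IH[OF dist j])
  \<comment> \<open>Axis \<open>i\<close> is not among the remaining ones, so
    \<open>l i = j i\<close> on \<open>?A is\<close>, and the second argument of
    \<open>\<kappa>\<close> no longer depends on \<open>l\<close>.\<close>
  also have "\<dots> = (\<Sum>l\<in>?A is. \<Sum>t<N. u (l(i := t)) * (\<kappa> t (j i) * ?p l))"
    using i by (intro sum.cong) (auto simp: step sum_distrib_right mult.assoc)
  also have "\<dots> = (\<Sum>(l, t)\<in>?A is \<times> {..<N}. u (l(i := t)) * (\<kappa> t (j i) * ?p l))"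
    by (rule sum.cartesian_product)
  also have "\<dots> = (\<Sum>l\<in>?A (i # is). u l * (\<kappa> (l i) (j i) * ?p l))"
  \<comment> \<open>A point frozen in coordinate \<open>i\<close> together with a free value
    \<open>t\<close> amounts to a point that is free in coordinate \<open>i\<close>. The inverse map
    records \<open>l i\<close> and restores \<open>j i\<close>. Goal 5, the equality of the
    summands, holds because \<open>?p\<close> does not look at coordinate \<open>i\<close>.\<close>
  proof (rule sum.reindex_bij_witness[of _ "\<lambda>l. (l(i := j i), l i)" "\<lambda>(l, t). l(i := t)"],
      goal_cases)
    case (5 x)
    have "?p ((fst x)(i := snd x)) = ?p (fst x)"
      using i by (intro prod.cong) auto
    then show ?case by (auto simp: case_prod_beta)
  qed (use i j in \<open>auto simp: grid_def fun_eq_iff\<close>)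
  finally show ?case using i by simp
qed

lemma result_grid_transform:
  fixes \<kappa> :: "nat \<Rightarrow> nat \<Rightarrow> complex" and j :: "'d::finite \<Rightarrow> nat"
  assumes "\<And>u k. k < N \<Longrightarrow> result (F N u) k = (\<Sum>t<N. u t * \<kappa> t k)" "0 < N" "j \<in> grid N"
  shows "result (grid_transform F N u) j = (\<Sum>l\<in>grid N. u l * (\<Prod>i\<in>UNIV. \<kappa> (l i) (j i)))"
  using result_axis_passes[where F = F and N = N and \<kappa> = \<kappa>, OF assms(1,2) set_all_axes(1) assms(3)]
  by (simp add: grid_transform_def set_all_axes)

text \<open>Each pass calls the routine once per grid line. The bound \<open>T\<close> must be
  uniform in the input, since later passes act on the output of earlier ones.\<close>

lemma mults_axis_passes:
  fixes u :: "('d::finite \<Rightarrow> nat) \<Rightarrow> complex"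
  assumes "\<And>u. mults (F N u) \<le> T" "0 < N"
  shows "mults (axis_passes F N is u) \<le> length is * (N ^ (CARD('d) - 1) * T)"
proof (induction "is" arbitrary: u)
  case Nil
  show ?case by (simp add: return_def)
next
  case (Cons i "is")
  have "mults (axis_pass F N i u) \<le> N ^ (CARD('d) - 1) * T"
    using sum_bounded_above[of "{l \<in> grid N. l i = 0}" "\<lambda>l. mults (F N (\<lambda>t. u (l(i := t))))" T] assms
    by (simp add: axis_pass_def seq_def for_each_def return_def card_grid_lines)
  then show ?case using Cons.IH[of "result (axis_pass F N i u)"] by (simp add: seq_def)
qed

lemma mults_grid_transform:
  fixes u :: "('d::finite \<Rightarrow> nat) \<Rightarrow> complex"
  assumes "\<And>u. mults (F N u) \<le> T" "0 < N"
  shows "mults (grid_transform F N u) \<le> CARD('d) * (N ^ (CARD('d) - 1) * T)"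
proof -
  have "length (all_axes :: 'd list) = CARD('d)"
    using set_all_axes[where 'd = 'd] distinct_card by metis
  then show ?thesis
    using mults_axis_passes[where F = F, OF assms, of all_axes u] by (simp add: grid_transform_def)
qed

section \<open>Phases at grid points and grid frequencies\<close>

lemma cis_sum: "cis (\<Sum>i\<in>A. f i) = (\<Prod>i\<in>A. cis (f i))"
  by (induction A rule: infinite_finite_induct) (auto simp: cis_mult[symmetric])

text \<open>The wrap-around of the frequencies changes the phases by multiples of \<open>2 * pi\<close> only.\<close>

lemma cis_grid_point_freq:
  fixes a :: "real ^ 'd"
  assumes "0 < L" "0 < N"
  shows "cis (grid_point a L N j \<bullet> grid_freq L N k) =
    cis (a \<bullet> grid_freq L N k) * (\<Prod>i\<in>UNIV. cis (2 * pi * real (j i) * real (k i) / real N))"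
proof -
  have "cis (L / real N * real (j i) * grid_freq L N k $ i) =
      cis (2 * pi * real (j i) * real (k i) / real N)" for i
  proof (cases "2 * k i < N")
    case True
    then show ?thesis using assms by (simp add: grid_freq_def field_simps)
  next
    case False
    have "L / real N * real (j i) * grid_freq L N k $ i =
        2 * pi * real (j i) * real (k i) / real N - 2 * pi * real (j i)"
      using False assms by (simp add: grid_freq_def field_simps)
    then show ?thesis by (simp flip: cis_divide add: cis_multiple_2pi)
  qed
  moreover have "grid_point a L N j \<bullet> grid_freq L N k =
      a \<bullet> grid_freq L N k + (\<Sum>i\<in>UNIV. L / real N * real (j i) * grid_freq L N k $ i)"
    by (simp add: inner_vec_def grid_point_def distrib_right sum.distrib)
  ultimately show ?thesis by (simp add: cis_sum flip: cis_mult)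
qed

section \<open>Quadrature integrals as sums over indices, and the Fourier constants\<close>

lemma inj_on_grid_point:
  assumes "0 < L" "0 < N"
  shows "inj_on (grid_point a L N) (grid N)"
  using assms by (auto simp: inj_on_def grid_point_def vec_eq_iff)

text \<open>For indices below \<open>N\<close>, wrapped frequencies are negative and the others
  nonnegative, so the two branches cannot collide; within a branch the map is affine with nonzero
  slope.\<close>

lemma inj_on_grid_freq:
  assumes "0 < L"
  shows "inj_on (grid_freq L N :: ('d::finite \<Rightarrow> nat) \<Rightarrow> real ^ 'd) (grid N)"
proof (intro inj_onI ext)
  fix k l :: "'d \<Rightarrow> nat" and i
  assume "k \<in> grid N" "l \<in> grid N" and eq: "(grid_freq L N k :: real ^ 'd) = grid_freq L N l"
  then have "k i < N" "l i < N" by (auto simp: grid_def)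
  moreover have "(grid_freq L N k :: real ^ 'd) $ i = grid_freq L N l $ i" using eq by simp
  ultimately show "k i = l i" using assms by (auto simp: grid_freq_def split: if_splits)
qed

text \<open>The point measure lives on the image of the index grid; injectivity of the
  parametrization lets the sum over the image become a sum over indices.\<close>

lemma integral_space_quadrature:
  fixes f :: "real ^ 'd \<Rightarrow> complex"
  assumes "0 < L" "0 < N"
  shows "(LINT x|space_quadrature a L N. f x) =
    of_real ((L / real N) ^ CARD('d)) * (\<Sum>j\<in>grid N. f (grid_point a L N j))"
  using assms unfolding space_quadrature_def
  by (simp add: lebesgue_integral_point_measure_finite sum.reindex inj_on_grid_point
      scaleR_conv_of_real sum_distrib_left del: of_real_power of_real_divide)

lemma integral_freq_quadrature:
  fixes f :: "real ^ 'd \<Rightarrow> complex"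
  assumes "0 < L"
  shows "(LINT x|freq_quadrature L N. f x) =
    of_real ((2 * pi / L) ^ CARD('d)) * (\<Sum>k\<in>grid N. f (grid_freq L N k))"
  using assms unfolding freq_quadrature_def
  by (simp add: lebesgue_integral_point_measure_finite sum.reindex inj_on_grid_freq
      scaleR_conv_of_real sum_distrib_left del: of_real_power of_real_divide)

lemma fourier_factor_square:
  "fourier_factor TYPE('d::finite) * fourier_factor TYPE('d) = of_real (1 / (2 * pi) ^ CARD('d))"
proof -
  have "(2 * pi) powr (- real CARD('d) / 2) * (2 * pi) powr (- real CARD('d) / 2) =
      1 / (2 * pi) ^ CARD('d)"
    by (simp flip: powr_add add: powr_minus powr_realpow divide_simps)
  then show ?thesis by (simp add: fourier_factor_def flip: of_real_mult)
qed

section \<open>From asymptotic to uniform bounds\<close>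

text \<open>The Landau bound can fail only for finitely many \<open>N\<close>, and their ratios can
  be absorbed into the constant. The range starts at 2 because \<open>ln 1 = 0\<close>.\<close>

lemma fft_algorithm_bound:
  assumes "fft_algorithm F D"
  obtains T :: "nat \<Rightarrow> nat" and C where "\<And>N u. mults (F N u) \<le> T N" "0 \<le> C"
    "\<And>N. 2 \<le> N \<Longrightarrow> real (T N) \<le> C * (real N * ln (real N))"
proof -
  obtain T :: "nat \<Rightarrow> nat" where T: "\<And>N u. mults (F N u) \<le> T N"
    and O: "(\<lambda>N. real (T N)) \<in> O(\<lambda>N. real N * ln (real N))"
    using assms by (auto simp: fft_algorithm_def)
  obtain c where "\<forall>\<^sub>F N in at_top. norm (real (T N)) \<le> c * norm (real N * ln (real N))"
    using landau_o.bigE[OF O] by blast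
  then obtain N0 where c: "\<And>N. N0 \<le> N \<Longrightarrow> real (T N) \<le> c * \<bar>real N * ln (real N)\<bar>"
    by (auto simp: eventually_at_top_linorder)
  let ?r = "\<lambda>N. real (T N) / (real N * ln (real N))"
  \<comment> \<open>All ratios are nonnegative, so their sum dominates each of the exceptional ones.
    The absolute value keeps \<open>?C\<close> nonnegative and above \<open>c\<close>.\<close>
  let ?C = "\<bar>c\<bar> + (\<Sum>N\<in>{2..<N0}. ?r N)"
  \<comment> \<open>For \<open>N = 0\<close> and \<open>N = 1\<close> the denominator vanishes and
    the quotient is 0 by convention.\<close>
  have r: "0 \<le> ?r N" for N by (cases "N = 0") auto
  have "real (T N) \<le> ?C * (real N * ln (real N))" if N: "2 \<le> N" for N
  proof -
    have pos: "0 < real N * ln (real N)" using N by simp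
    have "?r N \<le> ?C"
    proof (cases "N0 \<le> N")
      case True
      then have "?r N \<le> c" using c[of N] pos by (simp add: divide_le_eq)
      moreover have "0 \<le> (\<Sum>N\<in>{2..<N0}. ?r N)" by (rule sum_nonneg) (rule r)
      ultimately show ?thesis by linarith
    next
      case False
      then have "?r N \<le> (\<Sum>N\<in>{2..<N0}. ?r N)" using N r by (intro member_le_sum) auto
      then show ?thesis by linarith
    qed
    then show ?thesis using pos by (simp add: divide_le_eq)
  qed
  moreover have "0 \<le> ?C" by (intro add_nonneg_nonneg sum_nonneg r) simp
  ultimately show ?thesis using that T by blast
qed

section \<open>Correctness and cost of the algorithm\<close>

text \<open>The agreement is exact, not approximate: transforms and quadrature rules use the same
  nodes, so both sides reduce to the same sums over indices.\<close>

lemma result_interpolation_algorithm: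
  fixes a :: "real ^ 'd"
  assumes fft: "fft_algorithm fft dft" and ifft: "fft_algorithm ifft inverse_dft"
    and "0 < L" "0 < N" and j: "j \<in> grid N"
  shows "result (interpolation_algorithm fft ifft a L N q c M cs \<phi> v) j =
    interpolated_operator (space_quadrature a L N) (freq_quadrature L N)
      q c M cs \<phi> v (grid_point a L N j)"
proof -
  let ?x = "grid_point a L N :: _ \<Rightarrow> real ^ 'd" and ?\<xi> = "grid_freq L N :: _ \<Rightarrow> real ^ 'd"
  let ?d = "CARD('d)" and ?f = "fourier_factor TYPE('d)"
  \<comment> \<open>This is the kernel of the inverse transform without its normalization; its
    conjugate is the kernel of the forward transform.\<close>
  let ?e = "\<lambda>j k :: 'd \<Rightarrow> nat. \<Prod>i\<in>UNIV. cis (2 * pi * real (j i) * real (k i) / real N)"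
  define w where "w = result (grid_transform fft N (\<lambda>j. v (?x j)))"
  have w: "w k = (\<Sum>l\<in>grid N. v (?x l) * cnj (?e l k))" if "k \<in> grid N" for k
    unfolding w_def
    by (subst result_grid_transform[where F = fft and
          \<kappa> = "\<lambda>t k. cis (- (2 * pi * real t * real k / real N))"])
      (use that fft \<open>0 < N\<close> in \<open>auto simp: fft_algorithm_def dft_def cis_cnj\<close>)
  have inv: "result (grid_transform ifft N u) j =
      1 / of_nat N ^ ?d * (\<Sum>k\<in>grid N. u k * ?e j k)" for u
  proof -
    \<comment> \<open>The normalization \<open>1 / N\<close> is made part of the one-dimensional
      kernel, so it enters once per axis.\<close>
    have "result (grid_transform ifft N u) j = (\<Sum>k\<in>grid N. u k *
        (\<Prod>i\<in>UNIV. 1 / of_nat N * cis (2 * pi * real (j i) * real (k i) / real N)))"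
      by (rule result_grid_transform[where
            \<kappa> = "\<lambda>k j. 1 / of_nat N * cis (2 * pi * real j * real k / real N)"])
        (use j ifft \<open>0 < N\<close> in
          \<open>auto simp: fft_algorithm_def inverse_dft_def sum_distrib_left mult_ac\<close>)
    then show ?thesis
      by (simp add: prod.distrib power_one_over prod_dividef sum_divide_distrib)
  qed
  have ft: "fourier_transform (space_quadrature a L N) v (?\<xi> k) =
      ?f * of_real ((L / real N) ^ ?d) * cnj (cis (a \<bullet> ?\<xi> k)) * w k" if "k \<in> grid N" for k
  proof -
    have "cis (- (?x l \<bullet> ?\<xi> k)) = cnj (cis (a \<bullet> ?\<xi> k)) * cnj (?e l k)" for l
      using cis_grid_point_freq[of L N a l k] \<open>0 < L\<close> \<open>0 < N\<close>
      by (metis cis_cnj complex_cnj_mult)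
    then show ?thesis using that \<open>0 < L\<close> \<open>0 < N\<close>
      by (simp add: fourier_transform_def integral_space_quadrature w sum_distrib_left mult_ac)
  qed
  have scale: "?f * ?f * of_real ((L / real N) ^ ?d) * of_real ((2 * pi / L) ^ ?d) =
      1 / of_nat N ^ ?d"
    using \<open>0 < L\<close> by (simp add: fourier_factor_square power_divide power_mult_distrib)
  have freq: "?f * (LINT \<xi>|freq_quadrature L N. q (cs m) \<xi> *
        fourier_transform (space_quadrature a L N) v \<xi> * cis (?x j \<bullet> \<xi>)) =
      1 / of_nat N ^ ?d * (\<Sum>k\<in>grid N. q (cs m) (?\<xi> k) * w k * ?e j k)" for m
  proof -
    have "q (cs m) (?\<xi> k) * fourier_transform (space_quadrature a L N) v (?\<xi> k) *
        cis (?x j \<bullet> ?\<xi> k) =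
        ?f * of_real ((L / real N) ^ ?d) * (q (cs m) (?\<xi> k) * w k * ?e j k)" if "k \<in> grid N" for k
    proof -
      have "cnj (cis (a \<bullet> ?\<xi> k)) * cis (a \<bullet> ?\<xi> k) = 1" by (simp add: cis_cnj cis_mult)
      then have "q (cs m) (?\<xi> k) * (?f * of_real ((L / real N) ^ ?d) * cnj (cis (a \<bullet> ?\<xi> k)) * w k) *
          (cis (a \<bullet> ?\<xi> k) * ?e j k) =
          ?f * of_real ((L / real N) ^ ?d) * (q (cs m) (?\<xi> k) * w k * ?e j k)"
        by algebra
      then show ?thesis using that \<open>0 < L\<close> \<open>0 < N\<close> by (simp only: ft cis_grid_point_freq)
    qed
    then have "(\<Sum>k\<in>grid N. q (cs m) (?\<xi> k) *
        fourier_transform (space_quadrature a L N) v (?\<xi> k) * cis (?x j \<bullet> ?\<xi> k)) =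
        ?f * of_real ((L / real N) ^ ?d) * (\<Sum>k\<in>grid N. q (cs m) (?\<xi> k) * w k * ?e j k)"
      unfolding sum_distrib_left by (intro sum.cong refl)
    then have "?f * (LINT \<xi>|freq_quadrature L N. q (cs m) \<xi> *
        fourier_transform (space_quadrature a L N) v \<xi> * cis (?x j \<bullet> \<xi>)) =
      (?f * ?f * of_real ((L / real N) ^ ?d) * of_real ((2 * pi / L) ^ ?d)) *
        (\<Sum>k\<in>grid N. q (cs m) (?\<xi> k) * w k * ?e j k)"
      using \<open>0 < L\<close> by (simp only: integral_freq_quadrature mult_ac)
    then show ?thesis by (simp only: scale)
  qed
  have "result (interpolation_algorithm fft ifft a L N q c M cs \<phi> v) j =
      (\<Sum>m=1..M. of_real (\<phi> m (c (?x j))) *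
        (1 / of_nat N ^ ?d * (\<Sum>k\<in>grid N. q (cs m) (?\<xi> k) * w k * ?e j k)))"
    using j by (auto simp: interpolation_algorithm_def seq_def return_def for_each_def mult_def
        inv w_def intro!: sum.cong)
  also have "\<dots> = interpolated_operator (space_quadrature a L N) (freq_quadrature L N)
      q c M cs \<phi> v (?x j)"
    \<comment> \<open>Read backwards, \<open>freq\<close> turns each branch of the algorithm into a
      quadrature integral with its Fourier factor, which is then pulled out of the sum over
      \<open>m\<close>.\<close>
    unfolding freq[symmetric]
    unfolding interpolated_operator_def sum_distrib_left by (intro sum.cong refl mult.left_commute)
  finally show ?thesis .
qed

lemma mults_interpolation_algorithm:
  fixes a :: "real ^ 'd"
  assumes "\<And>u. mults (fft N u) \<le> T" "\<And>u. mults (ifft N u) \<le> T'" "0 < N"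
  shows "mults (interpolation_algorithm fft ifft a L N q c M cs \<phi> v) \<le>
    CARD('d) * (N ^ (CARD('d) - 1) * T) +
    M * (2 * N ^ CARD('d) + CARD('d) * (N ^ (CARD('d) - 1) * T'))"
proof -
  define w where "w = result (grid_transform fft N (\<lambda>j. v (grid_point a L N j)))"
  define u where "u m = (\<lambda>k\<in>grid N. q (cs m) (grid_freq L N k) * w k)" for m
  \<comment> \<open>The first \<open>N ^ CARD('d)\<close> counts the products with the symbol, the
    second those with the basis function. The forward transform is counted only once, as all
    branches share \<open>w\<close>.\<close>
  have "mults (interpolation_algorithm fft ifft a L N q c M cs \<phi> v) =
      mults (grid_transform fft N (\<lambda>j. v (grid_point a L N j))) +
      (\<Sum>m=1..M. N ^ CARD('d) + mults (grid_transform ifft N (u m)) + N ^ CARD('d))"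
    by (simp add: interpolation_algorithm_def seq_def return_def for_each_def mult_def card_grid
        u_def w_def)
  also have "\<dots> \<le> CARD('d) * (N ^ (CARD('d) - 1) * T) +
      (\<Sum>m=1..M. 2 * N ^ CARD('d) + CARD('d) * (N ^ (CARD('d) - 1) * T'))"
    using mults_grid_transform[where F = fft and 'd = 'd, OF assms(1,3)]
      mults_grid_transform[where F = ifft and 'd = 'd, OF assms(2,3)]
    by (intro add_mono[OF _ sum_mono]) simp_all
  finally show ?thesis by simp
qed

section \<open>A constant uniform in the grid size and the data\<close>

theorem lemma1:
  fixes fft ifft :: routine
  assumes "fft_algorithm fft dft" and "fft_algorithm ifft inverse_dft"
  shows "\<exists>K. \<forall>N\<ge>2. \<forall>(q :: real \<Rightarrow> real ^ 'd \<Rightarrow> complex) c cmin cmax M cs \<phi> a L v.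
    smooth c \<and> 0 < cmin \<and> (\<forall>x. cmin \<le> c x \<and> c x \<le> cmax) \<and>
    interpolation_basis cmin cmax M cs \<phi> \<and>
    0 < L \<and> closure {x. v x \<noteq> 0} \<subseteq> hypercube a L \<longrightarrow>
    (\<forall>j\<in>grid N. result (interpolation_algorithm fft ifft a L N q c M cs \<phi> v) j =
       interpolated_operator (space_quadrature a L N) (freq_quadrature L N)
         q c M cs \<phi> v (grid_point a L N j)) \<and>
    real (mults (interpolation_algorithm fft ifft a L N q c M cs \<phi> v))
      \<le> K * (real M * real N ^ CARD('d) * ln (real N))"
proof -
  obtain T C where T: "\<And>N u. mults (fft N u) \<le> T N" and "0 \<le> C"
    and C: "\<And>N. 2 \<le> N \<Longrightarrow> real (T N) \<le> C * (real N * ln (real N))"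
    using fft_algorithm_bound[OF assms(1)] by metis
  obtain T' C' where T': "\<And>N u. mults (ifft N u) \<le> T' N" and "0 \<le> C'"
    and C': "\<And>N. 2 \<le> N \<Longrightarrow> real (T' N) \<le> C' * (real N * ln (real N))"
    using fft_algorithm_bound[OF assms(2)] by metis
  let ?d = "CARD('d)"
  \<comment> \<open>The summands pay for the forward transform, the pointwise products and the
    inverse transforms, in this order. They depend only on the dimension and the two routines, so
    \<open>?K\<close> is fixed before \<open>N\<close>, \<open>M\<close> and the data.\<close>
  let ?K = "?d * C + (2 / ln 2 + ?d * C')"
  have "real (mults (interpolation_algorithm fft ifft a L N q c M cs \<phi> v))
      \<le> ?K * (real M * real N ^ ?d * ln (real N))"
    if N: "2 \<le> N" and M: "1 \<le> M"
    for N q c M cs \<phi> v L and a :: "real ^ 'd"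
  proof -
    let ?B = "real N ^ ?d * ln (real N)"
    have line: "?d * (real N ^ (?d - 1) * real t) \<le> ?d * B * ?B"
      if "real t \<le> B * (real N * ln (real N))" for t :: nat and B :: real
    proof -
      have "real N ^ (?d - 1) * real t \<le> real N ^ (?d - 1) * (B * (real N * ln (real N)))"
        using that by (intro mult_left_mono) auto
      \<comment> \<open>The dimension is positive, so the factor \<open>N\<close> of the
        one-dimensional bound completes \<open>N ^ (d - 1)\<close> to \<open>N ^ d\<close>.\<close>
      also have "\<dots> = B * ?B" by (simp add: power_eq_if)
      finally show ?thesis by (simp add: mult_left_mono mult.assoc)
    qed
    have "ln 2 \<le> ln (real N)" using N by simp
    then have point: "2 * real N ^ ?d \<le> 2 / ln 2 * ?B"
      using N by (simp add: field_simps)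
    have "0 \<le> ?d * C * ?B" using \<open>0 \<le> C\<close> N by simp
    \<comment> \<open>Since \<open>1 \<le> M\<close>, the single forward transform can be charged as
      if it were performed \<open>M\<close> times, which gives the bound its form proportional to
      \<open>M\<close>.\<close>
    then have "?d * C * ?B \<le> real M * (?d * C * ?B)"
      using M mult_right_mono[of 1 "real M" "?d * C * ?B"] by simp
    moreover have "real M * (2 * real N ^ ?d + ?d * (real N ^ (?d - 1) * real (T' N))) \<le>
        real M * (2 / ln 2 * ?B + ?d * C' * ?B)"
      by (intro mult_left_mono add_mono point line C' N) simp
    moreover have "real (mults (interpolation_algorithm fft ifft a L N q c M cs \<phi> v)) \<le>
        ?d * (real N ^ (?d - 1) * real (T N)) +
        real M * (2 * real N ^ ?d + ?d * (real N ^ (?d - 1) * real (T' N)))"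
      using of_nat_mono[where 'a = real, OF mults_interpolation_algorithm[
          where fft = fft and ifft = ifft, OF T T', of N a L q c M cs \<phi> v]] N
      by simp
    ultimately have "real (mults (interpolation_algorithm fft ifft a L N q c M cs \<phi> v)) \<le>
        real M * (?d * C * ?B) + real M * (2 / ln 2 * ?B + ?d * C' * ?B)"
      using line[OF C[OF N]] by linarith
    then show ?thesis by (simp add: algebra_simps)
  qed
  then show ?thesis
    by (intro exI[of _ ?K]) (auto simp: interpolation_basis_def
        intro!: result_interpolation_algorithm[OF assms])
qed

end
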